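(* Let $n\ge 1$ be an integer and let $U$ be a (rational) spectral unit of size $n$ with finite order, with Fourier coefficients $\xi_j$, $j\in\mathbb Z_n$. Then $\xi_0=\pm 1$. Moreover, for every integer $k$ coprime with $n$ and every $j\in\mathbb Z_n$ with $j\neq 0$: (i) if $n$ is even, then $\xi_{kj}=\xi_j^k$; (ii) if $n$ is odd, then $\xi_{kj}=\xi_j^k$, except when $k$ is even and $\xi_j=e^{(2p_j+1)i\pi/n}$ for some integer $p_j$, in which case $\xi_{kj}=-\xi_j^k$.
   Context: A matrix $M\in\mathcal M_n(\mathbb C)$, with rows and columns indexed by $\mathbb Z_n=\mathbb Z/n\mathbb Z$, is circulating (circulant) if there is a vector $(\alpha_0,\dots,\alpha_{n-1})$ such that its general coefficient is $m_{i,j}=\alpha_{i-j}$, the index $i-j$ being computed modulo $n$. A (rational) spectral unit of size $n$ is a circulating $n\times n$ matrix $U$ with entries in $\mathbb Q$ which is unitary: ${}^t\overline U=U^{-1}$. It has finite order if $U^m=I_n$ for some integer $m\ge 1$. If $(u_0,\dots,u_{n-1})$ is the first column of $U$, the Fourier coefficients of $U$ are $\xi_j=\sum_{s=0}^{n-1}u_s e^{2ijs\pi/n}$ for $j\in\mathbb Z_n$ (here $i=\sqrt{-1}$ in exponentials); these are the eigenvalues of $U$. Indices of $\xi$ are computed modulo $n$. *)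

theory Defs
  imports
    "HOL-Complex_Analysis.Complex_Analysis"
    "HOL-Computational_Algebra.Computational_Algebra"
    "HOL-Number_Theory.Number_Theory"
    "Jordan_Normal_Form.Schur_Decomposition"
begin

text \<open>Rows and columns are indexed by the representatives \<open>0, \<dots>, n - 1\<close> of the residues
  modulo \<open>n\<close>; \<open>i - j\<close> is taken in the integers before it is reduced.\<close>

definition circulant_mat :: "nat \<Rightarrow> complex mat \<Rightarrow> bool" where
  "circulant_mat n M \<longleftrightarrow> M \<in> carrier_mat n n \<and>
     (\<exists>\<alpha> \<in> carrier_vec n. \<forall>i<n. \<forall>j<n.
        M $$ (i, j) = \<alpha> $ nat ((int i - int j) mod int n))"

definition unitary_mat :: "nat \<Rightarrow> complex mat \<Rightarrow> bool" where
  "unitary_mat n M \<longleftrightarrow> M \<in> carrier_mat n n \<and>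
     inverts_mat M (mat_adjoint M) \<and> inverts_mat (mat_adjoint M) M"

definition rational_spectral_unit :: "nat \<Rightarrow> complex mat \<Rightarrow> bool" where
  "rational_spectral_unit n U \<longleftrightarrow>
     circulant_mat n U \<and> (\<forall>i<n. \<forall>j<n. U $$ (i, j) \<in> \<rat>) \<and> unitary_mat n U"

definition finite_order_mat :: "nat \<Rightarrow> complex mat \<Rightarrow> bool" where
  "finite_order_mat n U \<longleftrightarrow> (\<exists>m\<ge>1. U ^\<^sub>m m = 1\<^sub>m n)"

text \<open>The index ranges over all integers; the value depends only on its residue modulo \<open>n\<close>
  (see \<open>fourier_coeff_mod\<close>).\<close>

definition fourier_coeff :: "nat \<Rightarrow> complex mat \<Rightarrow> int \<Rightarrow> complex" where
  "fourier_coeff n U j =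
     (\<Sum>s<n. U $$ (s, 0) * exp (2 * \<i> * of_int j * of_nat s * of_real pi / of_nat n))"

lemma fourier_coeff_mod: "fourier_coeff n U (j mod int n) = fourier_coeff n U j"
proof (cases "n = 0")
  case True
  then show ?thesis by simp
next
  case False
  have "exp (2 * \<i> * of_int j * of_nat s * of_real pi / of_nat n :: complex) =
        exp (2 * \<i> * of_int (j mod int n) * of_nat s * of_real pi / of_nat n)" for s
  proof -
    define q where "q = j div int n"
    have "j = int n * q + j mod int n"
      by (simp add: q_def)
    then have j: "(of_int j :: complex) = of_nat n * of_int q + of_int (j mod int n)"
      by (metis of_int_add of_int_mult of_int_of_nat_eq)
    have "2 * \<i> * of_int j * of_nat s * of_real pi / of_nat n =
          2 * \<i> * of_int (j mod int n) * of_nat s * of_real pi / of_nat n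
          + (of_int (2 * (q * int s)) * of_real pi) * \<i>"
      unfolding j using False by (simp add: field_simps)
    then show ?thesis
      by (subst exp_eq) (auto intro!: exI[of _ "q * int s"])
  qed
  then show ?thesis
    by (simp add: fourier_coeff_def)
qed

end

theory Submission
  imports Defs
begin

text \<open>The coefficients \<open>\<xi>\<^sub>j\<close> are eigenvalues of \<open>U\<close>, hence \<open>M\<close>-th roots of unity if \<open>U\<^sup>M = 1\<close>.
  Instead of the Galois theory of cyclotomic fields we use a Frobenius congruence. Let \<open>D\<close> be a
  common denominator of the entries and \<open>p\<close> a prime not dividing \<open>D M\<close>. Then \<open>p\<close> divides
  \<open>D (\<xi>\<^sub>j\<^sup>p - \<xi>\<^sub>p\<^sub>j)\<close> in a ring \<open>\<int>[\<zeta>]\<close> generated by a root of unity. The difference of two distinct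
  \<open>M\<close>-th roots of unity divides \<open>M\<close>, and \<open>\<int>[\<zeta>]\<close> consists of algebraic integers, so
  \<open>\<xi>\<^sub>p\<^sub>j = \<xi>\<^sub>j\<^sup>p\<close>. By multiplicativity \<open>\<xi>\<^sub>k\<^sub>j = \<xi>\<^sub>j\<^sup>k\<close> for all \<open>k > 0\<close> coprime to \<open>K = D M\<close>.

  Let \<open>m\<close> be \<open>n\<close> or \<open>2 n\<close>, whichever is even. There is \<open>k \<equiv> 1\<close> modulo \<open>m\<close> with both \<open>k\<close> and
  \<open>k + m\<close> coprime to \<open>K\<close>, which forces \<open>\<xi>\<^sub>j\<^sup>m = 1\<close>; hence \<open>\<xi>\<^sub>k\<^sub>j = \<xi>\<^sub>j\<^sup>k\<close> for all \<open>k\<close> coprime to \<open>m\<close>.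
  If \<open>n\<close> is odd and \<open>k\<close> even, apply this to \<open>k + n\<close>; the sign is \<open>\<xi>\<^sub>j\<^sup>n = \<plusminus>1\<close>.\<close>

section \<open>Integer polynomials evaluated at roots of unity\<close>

abbreviation ieval :: "int poly \<Rightarrow> complex \<Rightarrow> complex" where
  "ieval f z \<equiv> poly (map_poly of_int f) z"

lemma ieval_add: "ieval (f + g) z = ieval f z + ieval g z"
  by (simp add: of_int_poly_hom.hom_add)

lemma ieval_mult: "ieval (f * g) z = ieval f z * ieval g z"
  by (simp add: of_int_poly_hom.hom_mult)

lemma ieval_power: "ieval (f ^ k) z = ieval f z ^ k"
  by (simp add: of_int_poly_hom.hom_power)

text \<open>The value is an eigenvalue of the integer matrix of multiplication by \<open>f(z)\<close> on
  \<open>1, z, \<dots>, z\<^bsup>N - 1\<^esup>\<close>.\<close>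

lemma algebraic_int_ieval_root_of_unity:
  fixes z :: complex
  assumes N: "N > 0" and z: "z ^ N = 1"
  shows "algebraic_int (ieval f z)"
proof -
  define A :: "int mat" where
    "A = mat N N (\<lambda>(i, j). \<Sum>k | k \<le> degree f \<and> (i + k) mod N = j. Polynomial.coeff f k)"
  define v where "v = vec N (\<lambda>i. z ^ i)"
  define B :: "complex mat" where "B = map_mat of_int A"
  have A: "A \<in> carrier_mat N N" and B: "B \<in> carrier_mat N N"
    by (auto simp: A_def B_def)
  have zmod: "z ^ (i mod N) = z ^ i" for i
  proof -
    have "z ^ i = z ^ (N * (i div N) + i mod N)" by simp
    then show ?thesis by (simp only: power_add power_mult z) simp
  qed
  have "eigenvector B v (ieval f z)"
    unfolding eigenvector_def
  proof (intro conjI)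
    show "v \<in> carrier_vec (dim_row B)" using B by (auto simp: v_def)
    have "v $ 0 = 1" using N by (simp add: v_def)
    then show "v \<noteq> 0\<^sub>v (dim_row B)" using B N by (metis carrier_matD(1) index_zero_vec(1) zero_neq_one)
    show "B *\<^sub>v v = ieval f z \<cdot>\<^sub>v v"
    proof (rule eq_vecI)
      show "dim_vec (B *\<^sub>v v) = dim_vec (ieval f z \<cdot>\<^sub>v v)"
        using B by (simp add: v_def)
      fix i assume "i < dim_vec (ieval f z \<cdot>\<^sub>v v)"
      then have i: "i < N" by (simp add: v_def)
      have "(B *\<^sub>v v) $ i = (\<Sum>j<N. B $$ (i, j) * z ^ j)"
        using i B by (auto simp: v_def scalar_prod_def lessThan_atLeast0)
      also have "\<dots> = (\<Sum>j<N. \<Sum>k | k \<in> {..degree f} \<and> (i + k) mod N = j. of_int (Polynomial.coeff f k) * z ^ (i + k))"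
      proof (rule sum.cong[OF refl])
        fix j assume j: "j \<in> {..<N}"
        have "B $$ (i, j) * z ^ j = (\<Sum>k | k \<in> {..degree f} \<and> (i + k) mod N = j. of_int (Polynomial.coeff f k) * z ^ j)"
          using i j by (simp add: B_def A_def sum_distrib_right)
        also have "\<dots> = (\<Sum>k | k \<in> {..degree f} \<and> (i + k) mod N = j. of_int (Polynomial.coeff f k) * z ^ (i + k))"
          by (intro sum.cong refl) (metis (mono_tags, lifting) mem_Collect_eq zmod)
        finally show "B $$ (i, j) * z ^ j = \<dots>" .
      qed
      also have "\<dots> = (\<Sum>k\<le>degree f. of_int (Polynomial.coeff f k) * z ^ (i + k))"
        by (rule sum.group) (use N in auto)
      also have "\<dots> = ieval f z * z ^ i"
        by (simp add: poly_altdef power_add sum_distrib_left mult_ac)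
      finally show "(B *\<^sub>v v) $ i = (ieval f z \<cdot>\<^sub>v v) $ i"
        using i by (simp add: v_def)
    qed
  qed
  then have "poly (char_poly B) (ieval f z) = 0"
    using eigenvalue_root_char_poly[OF B] by (auto simp: eigenvalue_def)
  then have "ieval (char_poly A) (ieval f z) = 0"
    unfolding B_def of_int_hom.char_poly_hom[OF A] .
  moreover have "lead_coeff (char_poly A) = 1"
    using degree_monic_char_poly[OF A] by simp
  ultimately show ?thesis
    unfolding algebraic_int_altdef_ipoly by blast
qed

text \<open>For nonzero \<open>p\<close>, the quotient \<open>a / p\<close> is a rational algebraic
  integer, hence an integer. This brings divisibility by \<open>p\<close> in the ring generated by
  \<open>z\<close> back to the integers.\<close>

lemma dvd_of_eq_mult_ieval:
  fixes z :: complex and a p :: int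
  assumes "N > 0" "z ^ N = 1" "of_int a = of_int p * ieval f z"
  shows "p dvd a"
proof (cases "p = 0")
  case True
  then show ?thesis using assms by simp
next
  case False
  then have eq: "ieval f z = of_int a / of_int p" using assms by (simp add: field_simps)
  then have "ieval f z \<in> \<rat>" by simp
  then have "ieval f z \<in> \<int>"
    using rational_algebraic_int_is_int[OF algebraic_int_ieval_root_of_unity] assms by blast
  then obtain b where "ieval f z = of_int b" by (auto elim: Ints_cases)
  then have "(of_int a :: complex) = of_int (p * b)" using assms by simp
  then have "a = p * b" by (simp only: of_int_eq_iff)
  then show ?thesis by simp
qed

section \<open>The Frobenius congruence modulo a prime\<close>

lemma prime_dvd_freshman:
  fixes x y :: "'a :: comm_ring_1"
  assumes "prime p"
  shows "of_nat p dvd (x + y) ^ p - x ^ p - y ^ p"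
proof -
  have p: "p > 1" using assms by (rule prime_gt_1_nat)
  define h where "h k = of_nat (p choose k) * x ^ k * y ^ (p - k)" for k
  have "{..p} = insert 0 (insert p {1..<p})" using p by auto
  then have "(x + y) ^ p = h 0 + (h p + sum h {1..<p})"
    unfolding binomial_ring h_def using p by (subst \<open>{..p} = _\<close>) auto
  then have "(x + y) ^ p - x ^ p - y ^ p = sum h {1..<p}"
    by (simp add: h_def)
  moreover have "of_nat p dvd h k" if "k \<in> {1..<p}" for k
  proof -
    have "p dvd p choose k"
      using that assms by (intro dvd_choose_prime) auto
    then show ?thesis unfolding h_def by (auto elim!: dvdE)
  qed
  ultimately show ?thesis by (auto intro!: dvd_sum)
qed

lemma prime_dvd_power_diff:
  fixes c :: int
  assumes "prime p"
  shows "int p dvd c ^ p - c"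
proof (cases "int p dvd c")
  case True
  have "p > 0" using assms by (rule prime_gt_0_nat)
  then show ?thesis using True by (simp add: dvd_power dvd_diff dvd_trans[OF True])
next
  case False
  define d where "d = nat (c mod int p)"
  have p: "p > 0" using assms by (rule prime_gt_0_nat)
  then have d: "int d = c mod int p" by (simp add: d_def)
  have "\<not> p dvd d" using False d by (metis dvd_mod_iff int_dvd_int_iff dvd_refl)
  then have "[d ^ (p - 1) = 1] (mod p)" by (rule fermat_theorem[OF assms])
  then have "[d ^ (p - 1) * d = 1 * d] (mod p)" by (rule cong_scalar_right)
  moreover have "d ^ (p - 1) * d = d ^ p" using p by (metis power_minus_mult)
  ultimately have "[d ^ p = d] (mod p)" by (simp only: mult_1)
  then have "[int d ^ p = int d] (mod int p)" by (metis cong_int_iff of_nat_power)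
  moreover have "[int d = c] (mod int p)" by (simp add: d cong_def)
  ultimately have "[c ^ p = c] (mod int p)"
    by (meson cong_pow cong_sym cong_trans)
  then show ?thesis by (simp add: cong_iff_dvd_diff)
qed

text \<open>Additivity of the \<open>p\<close>-th power modulo \<open>p\<close> splits off the
  constant term, Fermat's little theorem replaces \<open>c ^ p\<close> by \<open>c\<close>, and the
  induction hypothesis is multiplied by \<open>X ^ p\<close>.\<close>

lemma prime_dvd_poly_frobenius:
  fixes f :: "int poly"
  assumes "prime p"
  shows "of_nat p dvd f ^ p - pcompose f (Polynomial.monom 1 p)"
proof (induction f)
  case 0
  then show ?case using assms by (simp add: prime_gt_0_nat zero_power)
next
  case (pCons c f)
  let ?X = "[:0, 1:] :: int poly"
  have split: "pCons c f = [:c:] + ?X * f" by simp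
  have *: "of_nat p dvd (pCons c f) ^ p - [:c:] ^ p - (?X * f) ^ p"
    unfolding split by (rule prime_dvd_freshman[OF assms])
  have "of_nat p = [:int p:]" by (simp add: of_nat_poly)
  moreover have "[:int p:] dvd [:c ^ p - c:]"
    using prime_dvd_power_diff[OF assms, of c] by (simp add: const_poly_dvd)
  ultimately have **: "of_nat p dvd [:c:] ^ p - [:c:]"
    by (simp add: poly_const_pow)
  have ***: "of_nat p dvd Polynomial.monom 1 p * (f ^ p - pcompose f (Polynomial.monom 1 p))"
    using pCons.IH by (rule dvd_mult)
  have X: "?X ^ p = Polynomial.monom 1 p" by (simp add: monom_altdef)
  have "pCons c f ^ p - pcompose (pCons c f) (Polynomial.monom 1 p) =
      (pCons c f ^ p - [:c:] ^ p - (?X * f) ^ p) + ([:c:] ^ p - [:c:])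
      + Polynomial.monom 1 p * (f ^ p - pcompose f (Polynomial.monom 1 p))"
    unfolding pcompose_pCons power_mult_distrib X by (simp add: algebra_simps)
  then show ?case using * ** *** by (simp only: dvd_add)
qed

lemma root_of_unity_eq_power:
  fixes z :: complex
  assumes "N > 0" "z ^ N = 1"
  obtains k where "z = exp (2 * of_real pi * \<i> / of_nat N) ^ k"
proof -
  obtain k where "z = exp (2 * of_real pi * \<i> * of_nat k / of_nat N)"
    using complex_roots_unity[of N] assms by auto
  then have "z = exp (2 * of_real pi * \<i> / of_nat N) ^ k"
    by (simp flip: exp_of_nat_mult add: mult_ac)
  then show ?thesis by (rule that)
qed

text \<open>The powers of \<open>x\<close> sum to zero, so the terms \<open>1 - x ^ k\<close> sum to
  \<open>M\<close>, and each is a multiple of \<open>1 - x\<close>. The cofactor is explicit so that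
  it can be written as an integer polynomial in a root of unity.\<close>

lemma root_of_unity_one_minus_dvd:
  fixes x :: "'a :: idom"
  assumes "x ^ M = 1" "x \<noteq> 1"
  shows "of_nat M = (1 - x) * (\<Sum>k<M. \<Sum>i<k. x ^ i)"
proof -
  have "(1 - x) * (\<Sum>k<M. x ^ k) = 0"
    using one_diff_power_eq[of x M] assms by simp
  then have "(\<Sum>k<M. x ^ k) = 0" using assms by simp
  moreover have "(1 - x) * (\<Sum>k<M. \<Sum>i<k. x ^ i) = (\<Sum>k<M. 1 - x ^ k)"
    by (simp add: sum_distrib_left one_diff_power_eq)
  ultimately show ?thesis by (simp add: sum_subtractf)
qed

text \<open>If \<open>w\<close> and \<open>u ^ p\<close> differed, their quotient \<open>g\<close>
  would be a nontrivial \<open>M\<close>-th root of unity, and \<open>1 - g\<close> would divide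
  \<open>M\<close>. Since \<open>p\<close> divides \<open>D * (u ^ p - w)\<close>, it would divide
  \<open>D * M\<close>.\<close>

lemma frobenius_root_of_unity_value:
  fixes y u w :: complex and D :: int
  assumes p: "prime p" "\<not> int p dvd D" "\<not> p dvd M"
    and y: "n > 0" "y ^ n = 1" and M: "M > 0" "u ^ M = 1" "w ^ M = 1"
    and u: "ieval f y = of_int D * u" and w: "ieval f (y ^ p) = of_int D * w"
  shows "w = u ^ p"
proof (rule ccontr)
  assume neq: "w \<noteq> u ^ p"
  \<comment> \<open>\<open>y\<close>, \<open>u\<close> and \<open>w\<close> are all powers of one
    \<open>N\<close>-th root of unity \<open>z\<close>, so a single ring contains every quantity
    involved.\<close>
  define N where "N = n * M"
  have N: "N > 0" using y M by (simp add: N_def)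
  define z :: complex where "z = exp (2 * of_real pi * \<i> / of_nat N)"
  have z: "z ^ N = 1" using N by (simp add: z_def flip: exp_of_nat_mult)
  have "y ^ N = 1" by (simp add: N_def power_mult y)
  then obtain a where a: "y = z ^ a" using root_of_unity_eq_power[OF N] z_def by blast
  have "u ^ N = 1" "w ^ N = 1" by (simp_all add: N_def mult.commute[of n] power_mult M)
  then obtain b c where b: "u = z ^ b" and c: "w = z ^ c"
    using root_of_unity_eq_power[OF N] z_def by metis
  \<comment> \<open>\<open>u ^ (p * (M - 1))\<close> is the inverse of \<open>u ^ p\<close>, so
    \<open>g\<close> is \<open>w / u ^ p\<close> written without division.\<close>
  define g where "g = w * u ^ (p * (M - 1))"
  have inv: "u ^ p * u ^ (p * (M - 1)) = 1"
  proof -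
    have "p + p * (M - 1) = M * p" using M(1) by (cases M) auto
    then show ?thesis by (simp only: flip: power_add) (simp add: power_mult M)
  qed
  have g1: "g \<noteq> 1"
  proof
    assume "g = 1"
    then have "w * (u ^ p * u ^ (p * (M - 1))) = u ^ p" unfolding g_def by (simp add: mult_ac)
    with inv have "w = u ^ p" by (simp only: mult_1_right)
    then show False using neq by simp
  qed
  have gM: "g ^ M = 1"
  proof -
    have "(u ^ (p * (M - 1))) ^ M = (u ^ M) ^ (p * (M - 1))"
      by (simp only: mult.commute flip: power_mult)
    then show ?thesis by (simp add: g_def power_mult_distrib M)
  qed
  define r where "r = (\<Sum>k<M. \<Sum>i<k. g ^ i)"
  have r: "of_nat M = (1 - g) * r"
    unfolding r_def by (rule root_of_unity_one_minus_dvd[OF gM g1])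
  obtain h where h: "f ^ p - pcompose f (Polynomial.monom 1 p) = of_nat p * h"
    using prime_dvd_poly_frobenius[OF p(1)] by (auto elim: dvdE)
  obtain e where e: "D ^ p - D = int p * e"
    using prime_dvd_power_diff[OF p(1)] by (auto elim: dvdE)
  have "f ^ p = pcompose f (Polynomial.monom 1 p) + of_nat p * h" using h by (simp add: algebra_simps)
  then have "ieval f y ^ p = ieval (pcompose f (Polynomial.monom 1 p)) y + of_nat p * ieval h y"
    by (metis ieval_add ieval_mult ieval_power of_int_poly_hom.hom_of_nat poly_of_nat)
  moreover have "ieval (pcompose f (Polynomial.monom 1 p)) y = ieval f (y ^ p)"
    by (simp add: of_int_hom.map_poly_pcompose poly_pcompose poly_monom)
  ultimately have "of_int (D ^ p) * u ^ p = of_int D * w + of_nat p * ieval h y"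
    by (simp add: u w power_mult_distrib)
  moreover have "D ^ p = D + int p * e" using e by simp
  ultimately have diff: "of_int D * (u ^ p - w) = of_nat p * (ieval h y - of_int e * u ^ p)"
    by (simp add: algebra_simps)
  \<comment> \<open>The three factors take at \<open>z\<close> the values of the Frobenius
    remainder, the inverse of \<open>u ^ p\<close> and the cofactor \<open>r\<close>.\<close>
  define q where "q = (pcompose h (Polynomial.monom 1 a) - of_int e * Polynomial.monom 1 (b * p)) * Polynomial.monom 1 (b * (p * (M - 1)))
    * (\<Sum>k<M. \<Sum>i<k. Polynomial.monom 1 ((c + b * (p * (M - 1))) * i))"
  have q: "ieval q z = (ieval h y - of_int e * u ^ p) * u ^ (p * (M - 1)) * r"
    by (simp add: q_def r_def g_def a b c of_int_poly_hom.hom_mult of_int_poly_hom.hom_minus of_int_poly_hom.hom_of_int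
        of_int_poly_hom.hom_sum of_int_hom.map_poly_pcompose poly_pcompose poly_monom poly_sum
        power_mult power_add)
  have "of_int (D * int M) = of_int D * ((u ^ p * u ^ (p * (M - 1)) - g) * r)"
    using r inv by simp
  also have "\<dots> = of_int D * (u ^ p - w) * u ^ (p * (M - 1)) * r"
    by (simp add: g_def algebra_simps)
  also have "\<dots> = of_int (int p) * ieval q z"
    unfolding diff q by simp
  finally have "int p dvd D * int M" by (rule dvd_of_eq_mult_ieval[OF N z])
  then show False using p by (simp add: prime_dvd_mult_iff)
qed

section \<open>Exponents coprime to \<open>K\<close> and their residues modulo
  \<open>m\<close>\<close>

lemma power_map_of_primes:
  fixes \<xi> :: "int \<Rightarrow> complex"
  assumes "\<And>p j. prime p \<Longrightarrow> coprime p K \<Longrightarrow> \<xi> (int p * j) = \<xi> j ^ p"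
    and "k > 0" "coprime k K"
  shows "\<xi> (int k * j) = \<xi> j ^ k"
  using assms(2,3)
proof (induction k arbitrary: j rule: prime_divisors_induct)
  case zero
  then show ?case by simp
next
  case (unit k)
  then show ?case by simp
next
  case (factor p k)
  then have "\<xi> (int p * (int k * j)) = \<xi> (int k * j) ^ p"
    by (intro assms(1)) auto
  also have "\<xi> (int k * j) = \<xi> j ^ k" using factor by auto
  finally show ?case by (metis mult.assoc mult.commute of_nat_mult power_mult)
qed

text \<open>\<open>L\<close> is the product of the primes dividing \<open>K\<close> but not \<open>m\<close>.\<close>

lemma coprime_part:
  fixes K m :: nat
  assumes "K > 0"
  obtains L where "L > 0" "coprime L m" "\<And>x. coprime x m \<Longrightarrow> coprime x L \<Longrightarrow> coprime x K"
proof
  define P where "P = {q \<in> prime_factors K. \<not> q dvd m}"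
  have P: "finite P" "\<And>q. q \<in> P \<Longrightarrow> prime q" by (auto simp: P_def)
  show "\<Prod>P > 0" using P by (auto intro!: prod_pos simp: prime_gt_0_nat)
  show "coprime (\<Prod>P) m"
    by (rule prod_coprime_left) (auto simp: P_def intro!: prime_imp_coprime)
  fix x assume x: "coprime x m" "coprime x (\<Prod>P)"
  show "coprime x K"
  proof (rule ccontr)
    assume "\<not> coprime x K"
    then obtain q where q: "prime q" "q dvd x" "q dvd K"
      by (metis coprime_iff_gcd_eq_1 gcd_greatest_iff prime_factor_nat)
    then have "\<not> q dvd m" using x(1)
      by (meson coprime_common_divisor not_prime_unit)
    then have "q \<in> P" using q assms by (auto simp: P_def in_prime_factors_iff)
    then have "q dvd \<Prod>P" using P by (intro dvd_prodI) auto
    then show False using x(2) q by (meson coprime_common_divisor not_prime_unit)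
  qed
qed

lemma exists_pos_cong:
  fixes m L :: nat
  assumes "m > 0" "L > 0" "coprime L m"
  obtains k :: nat where "k > 0" "[int k = a] (mod int m)" "[int k = b] (mod int L)"
proof -
  have "coprime (int m) (int L)" using assms(3) by (simp add: ac_simps)
  then obtain x where x: "[x = a] (mod int m)" "[x = b] (mod int L)"
    using binary_chinese_remainder_int by blast
  \<comment> \<open>The summand \<open>m * L\<close> makes \<open>k\<close> positive without
    changing its residues.\<close>
  define k where "k = nat (x mod int (m * L)) + m * L"
  have k: "int k = x mod int (m * L) + int (m * L)" using assms by (simp add: k_def)
  have "[int k = x] (mod int (m * L))" by (simp add: k cong_def)
  then have "[int k = x] (mod int m)" "[int k = x] (mod int L)"
    by (auto intro: cong_dvd_modulus)
  then show ?thesis using x assms by (intro that[of k]) (auto intro: cong_trans simp: k_def)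
qed

text \<open>Residue 1 modulo \<open>L\<close> excludes the primes of \<open>K\<close> that do not
  divide \<open>m\<close>; the residue \<open>a\<close> excludes those that do.\<close>

lemma exists_coprime_cong:
  fixes m K :: nat
  assumes "m > 0" "K > 0" "coprime a (int m)"
  obtains k :: nat where "k > 0" "[int k = a] (mod int m)" "coprime k K"
proof -
  obtain L where L: "L > 0" "coprime L m" "\<And>x. coprime x m \<Longrightarrow> coprime x L \<Longrightarrow> coprime x K"
    using coprime_part[OF assms(2)] by blast
  obtain k where k: "k > 0" "[int k = a] (mod int m)" "[int k = 1] (mod int L)"
    using exists_pos_cong[OF assms(1) L(1,2)] by blast
  have "coprime (int k) (int m)" using k(2) assms(3) by (meson cong_imp_coprime cong_sym)
  moreover have "coprime (int k) (int L)" using k(3) by (meson cong_imp_coprime cong_sym coprime_1_left)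
  ultimately show ?thesis using k L(3) by (intro that[of k]) auto
qed

text \<open>Choosing \<open>k \<equiv> m\<close> modulo \<open>L\<close> gives \<open>k + m \<equiv> 2 m\<close>, a unit because \<open>L\<close> is odd.\<close>

lemma exists_coprime_shift:
  fixes m K :: nat
  assumes "m > 0" "K > 0" "even m"
  obtains k :: nat where "k > 0" "[int k = 1] (mod int m)" "coprime k K" "coprime (k + m) K"
proof -
  obtain L where L: "L > 0" "coprime L m" "\<And>x. coprime x m \<Longrightarrow> coprime x L \<Longrightarrow> coprime x K"
    using coprime_part[OF assms(2)] by blast
  obtain k where k: "k > 0" "[int k = 1] (mod int m)" "[int k = int m] (mod int L)"
    using exists_pos_cong[OF assms(1) L(1,2)] by blast
  have 1: "coprime (int k) (int m)" using k(2) by (meson cong_imp_coprime cong_sym coprime_1_left)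
  have 2: "coprime (int k) (int L)"
    using k(3) L(2) by (metis cong_imp_coprime cong_sym coprime_commute coprime_int_iff)
  have "odd L" using L(2) assms(3) by (meson coprime_common_divisor odd_one)
  then have "coprime (2 * int m) (int L)" using L(2) by (simp add: ac_simps)
  moreover have "[int (k + m) = 2 * int m] (mod int L)"
    using cong_add[OF k(3) cong_refl[of "int m"]] by simp
  ultimately have "coprime (int (k + m)) (int L)" by (meson cong_imp_coprime cong_sym)
  moreover have "coprime (int (k + m)) (int m)" 
    using 1 by (metis coprime_iff_gcd_eq_1 gcd_add1 of_nat_add)
  ultimately have "coprime (k + m) K" by (intro L(3)) (auto simp del: of_nat_add)
  moreover have "coprime k K" using 1 2 by (intro L(3)) auto
  ultimately show ?thesis using k by (intro that[of k]) auto
qed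


section \<open>Fourier coefficients as eigenvalues of a circulant matrix\<close>

definition nth_root :: "nat \<Rightarrow> int \<Rightarrow> complex" where
  "nth_root n j = exp (2 * \<i> * of_int j * of_real pi / of_nat n)"

lemma nth_root_power_self: "n > 0 \<Longrightarrow> nth_root n j ^ n = 1"
  by (simp add: nth_root_def mult_ac flip: exp_of_nat_mult)

lemma nth_root_mult: "nth_root n (int k * j) = nth_root n j ^ k"
  by (simp add: nth_root_def mult_ac flip: exp_of_nat_mult)

lemma fourier_coeff_eq_sum:
  "fourier_coeff n U j = (\<Sum>s<n. U $$ (s, 0) * nth_root n j ^ s)"
  by (simp add: fourier_coeff_def nth_root_def mult_ac flip: exp_of_nat_mult)

lemma power_int_mod_order:
  fixes y :: "'a :: field"
  assumes "y ^ n = 1" "n > 0"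
  shows "y powi (k mod int n) = y powi k"
proof -
  have "y \<noteq> 0" using assms by (auto simp: zero_power)
  then have "y powi (int n * (k div int n) + k mod int n) = (y powi int n) powi (k div int n) * y powi (k mod int n)"
    by (subst power_int_add) (simp_all add: power_int_mult)
  then show ?thesis using assms by simp
qed

text \<open>The vector is a character of the residues modulo \<open>n\<close>, and a circulant
  matrix acts by convolution. The negative exponent gives the eigenvalue the form of a Fourier
  coefficient.\<close>

lemma eigenvector_circulant:
  assumes n: "n > 0" and U: "circulant_mat n U" and y: "y ^ n = 1"
  shows "eigenvector U (vec n (\<lambda>k. y powi (- int k))) (\<Sum>s<n. U $$ (s, 0) * y ^ s)"
    (is "eigenvector U ?v ?x")
proof -
  have C: "U \<in> carrier_mat n n" using U by (simp add: circulant_mat_def)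
  \<comment> \<open>For fixed \<open>i\<close>, the reflection \<open>\<sigma> i\<close> is an
    involution of the indices, so it reindexes the sum over row \<open>i\<close> by the first
    column.\<close>
  define \<sigma> where "\<sigma> i k = nat ((int i - int k) mod int n)" for i k
  have \<sigma>: "int (\<sigma> i k) = (int i - int k) mod int n" for i k
    using n by (simp add: \<sigma>_def)
  have \<sigma>_less: "\<sigma> i k < n" for i k
    using n by (simp add: \<sigma>_def nat_less_iff)
  have \<sigma>\<sigma>: "\<sigma> i (\<sigma> i k) = k" if "k < n" for i k
  proof -
    have "int (\<sigma> i (\<sigma> i k)) = int k"
      using that by (simp only: \<sigma> mod_diff_right_eq) simp
    then show ?thesis by simp
  qed
  obtain \<alpha> :: "complex Matrix.vec" where \<alpha>: "\<And>i k. i < n \<Longrightarrow> k < n \<Longrightarrow> U $$ (i, k) = \<alpha> $ \<sigma> i k"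
    using U by (auto simp: circulant_mat_def \<sigma>_def)
  have "\<sigma> s 0 = s" if "s < n" for s using that by (simp add: \<sigma>_def)
  then have U\<sigma>: "U $$ (i, k) = U $$ (\<sigma> i k, 0)" if "i < n" "k < n" for i k
    using that \<alpha> \<sigma>_less n by simp
  have y0: "y \<noteq> 0" using y n by (auto simp: zero_power)
  show ?thesis
    unfolding eigenvector_def
  proof (intro conjI)
    show "?v \<in> carrier_vec (dim_row U)" using C by auto
    have "?v $ 0 = 1" using n by simp
    then show "?v \<noteq> 0\<^sub>v (dim_row U)" using C n by (metis carrier_matD(1) index_zero_vec(1) zero_neq_one)
    show "U *\<^sub>v ?v = ?x \<cdot>\<^sub>v ?v"
    proof (rule eq_vecI)
      show "dim_vec (U *\<^sub>v ?v) = dim_vec (?x \<cdot>\<^sub>v ?v)" using C by simp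
      fix i assume "i < dim_vec (?x \<cdot>\<^sub>v ?v)"
      then have i: "i < n" by simp
      have "(U *\<^sub>v ?v) $ i = (\<Sum>k<n. U $$ (i, k) * y powi (- int k))"
        using i C by (auto simp: scalar_prod_def lessThan_atLeast0)
      also have "\<dots> = (\<Sum>k<n. U $$ (\<sigma> i k, 0) * y ^ \<sigma> i k * y powi (- int i))"
      proof (rule sum.cong[OF refl])
        fix k assume "k \<in> {..<n}"
        have "y ^ \<sigma> i k = y powi (int i - int k)"
          by (simp add: \<sigma> power_int_mod_order[OF y n] flip: power_int_of_nat)
        then have "y ^ \<sigma> i k * y powi (- int i) = y powi (- int k)"
          using y0 by (simp flip: power_int_add)
        then show "U $$ (i, k) * y powi (- int k) = U $$ (\<sigma> i k, 0) * y ^ \<sigma> i k * y powi (- int i)"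
          using U\<sigma>[of i k] i \<open>k \<in> {..<n}\<close> by (simp add: mult.assoc)
      qed
      also have "\<dots> = (\<Sum>s<n. U $$ (s, 0) * y ^ s * y powi (- int i))"
        by (rule sum.reindex_bij_witness[of _ "\<sigma> i" "\<sigma> i"]) (auto simp: \<sigma>\<sigma> \<sigma>_less)
      finally show "(U *\<^sub>v ?v) $ i = (?x \<cdot>\<^sub>v ?v) $ i"
        using i by (simp add: sum_distrib_right)
    qed
  qed
qed

lemma fourier_coeff_root_of_unity:
  assumes n: "n > 0" and U: "circulant_mat n U" and M: "U ^\<^sub>m M = 1\<^sub>m n"
  shows "fourier_coeff n U j ^ M = 1"
proof -
  have C: "U \<in> carrier_mat n n" using U by (simp add: circulant_mat_def)
  let ?v = "vec n (\<lambda>k. nth_root n j powi (- int k))"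
  have ev: "eigenvector U ?v (fourier_coeff n U j)"
    unfolding fourier_coeff_eq_sum
    by (rule eigenvector_circulant[OF n U nth_root_power_self[OF n]])
  have "U ^\<^sub>m M *\<^sub>v ?v = fourier_coeff n U j ^ M \<cdot>\<^sub>v ?v"
    by (rule eigenvector_pow[OF C ev])
  then have "?v = fourier_coeff n U j ^ M \<cdot>\<^sub>v ?v" unfolding M by simp
  then have "?v $ 0 = (fourier_coeff n U j ^ M \<cdot>\<^sub>v ?v) $ 0" by simp
  then show ?thesis using n by simp
qed

lemma common_denominator:
  fixes g :: "'b \<Rightarrow> 'a :: field_char_0"
  assumes "finite S" "\<And>s. s \<in> S \<Longrightarrow> g s \<in> \<rat>"
  obtains D :: nat where "D > 0" "\<And>s. s \<in> S \<Longrightarrow> of_nat D * g s \<in> \<int>"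
proof -
  have "\<exists>d::nat. d > 0 \<and> of_nat d * g s \<in> \<int>" if s: "s \<in> S" for s
  proof -
    obtain a b :: int where "b > 0" "g s = of_int a / of_int b"
      using assms(2)[OF s] by (auto elim: Rats_cases')
    then show ?thesis by (intro exI[of _ "nat b"]) auto
  qed
  then obtain d :: "'b \<Rightarrow> nat" where d: "\<And>s. s \<in> S \<Longrightarrow> d s > 0 \<and> of_nat (d s) * g s \<in> \<int>"
    by metis
  show ?thesis
  proof (rule that[of "\<Prod>s\<in>S. d s"])
    show "prod d S > 0" using d by (auto intro!: prod_pos)
    fix s assume s: "s \<in> S"
    then have "of_nat (prod d S) * g s = of_nat (prod d (S - {s})) * (of_nat (d s) * g s)"
      using assms(1) by (simp add: prod.remove mult_ac)
    also have "\<dots> \<in> \<int>" using d[OF s] by (blast intro: Ints_mult Ints_of_nat)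
    finally show "of_nat (prod d S) * g s \<in> \<int>" .
  qed
qed

text \<open>Multiplied by \<open>D\<close>, the coefficients are values of one integer polynomial at
  \<open>nth_root n j\<close>, and multiplying the index by \<open>p\<close> raises the argument to
  the power \<open>p\<close>. The choice \<open>K = D * M\<close> excludes the primes dividing the
  denominator or the order.\<close>

lemma fourier_coeff_frobenius:
  assumes n: "n > 0" and U: "circulant_mat n U" and M: "M > 0" "U ^\<^sub>m M = 1\<^sub>m n"
    and rat: "\<And>s. s < n \<Longrightarrow> U $$ (s, 0) \<in> \<rat>"
  obtains K :: nat where "K > 0"
    "\<And>p j. prime p \<Longrightarrow> coprime p K \<Longrightarrow> fourier_coeff n U (int p * j) = fourier_coeff n U j ^ p"
proof -
  obtain D where D: "D > 0" "\<And>s. s \<in> {..<n} \<Longrightarrow> of_nat D * U $$ (s, 0) \<in> \<int>"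
    using common_denominator[of "{..<n}" "\<lambda>s. U $$ (s, 0)"] rat by auto
  then have "\<forall>s\<in>{..<n}. \<exists>b. of_nat D * U $$ (s, 0) = of_int b"
    by (blast elim: Ints_cases)
  then obtain a where "\<forall>s\<in>{..<n}. of_nat D * U $$ (s, 0) = of_int (a s)"
    by (rule bchoice[THEN exE])
  then have a: "\<And>s. s < n \<Longrightarrow> of_nat D * U $$ (s, 0) = of_int (a s)" by simp
  define f where "f = (\<Sum>s<n. Polynomial.monom (a s) s)"
  have f: "ieval f y = of_int (int D) * (\<Sum>s<n. U $$ (s, 0) * y ^ s)" for y
    by (simp add: f_def of_int_poly_hom.hom_sum poly_sum poly_monom sum_distrib_left
        flip: a mult.assoc)
  show ?thesis
  proof (rule that[of "D * M"])
    show "D * M > 0" using D M by simp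
    fix p :: nat and j assume p: "prime p" "coprime p (D * M)"
    then have "\<not> p dvd D" "\<not> p dvd M"
      by (auto simp: prime_nat_iff coprime_absorb_left)
    then have "\<not> int p dvd int D" "\<not> p dvd M" by auto
    moreover have "ieval f (nth_root n j) = of_int (int D) * fourier_coeff n U j"
      "ieval f (nth_root n j ^ p) = of_int (int D) * fourier_coeff n U (int p * j)"
      by (simp_all only: f fourier_coeff_eq_sum nth_root_mult)
    ultimately show "fourier_coeff n U (int p * j) = fourier_coeff n U j ^ p"
      using frobenius_root_of_unity_value[OF p(1) _ _ n nth_root_power_self[OF n, of j] M(1)
          fourier_coeff_root_of_unity[OF n U M(2)] fourier_coeff_root_of_unity[OF n U M(2)]]
      by blast
  qed
qed

section \<open>From exponents coprime to \<open>K\<close> to units modulo \<open>m\<close>\<close>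

text \<open>The modulus serves as \<open>m = n\<close> for even \<open>n\<close> and as
  \<open>m = 2 * n\<close> for odd \<open>n\<close>. If \<open>K\<close> is even, \<open>k\<close>
  and \<open>k + m\<close> can both be coprime to it only when \<open>m\<close> is even.\<close>

lemma power_map_of_units:
  fixes \<xi> :: "int \<Rightarrow> complex"
  assumes "n dvd m" "even m" "m > 0" "K > 0"
    and \<xi>_mod: "\<And>i j. [i = j] (mod int n) \<Longrightarrow> \<xi> i = \<xi> j"
    and \<xi>_nonzero: "\<And>j. \<xi> j \<noteq> 0"
    and power: "\<And>k j. k > 0 \<Longrightarrow> coprime k K \<Longrightarrow> \<xi> (int k * j) = \<xi> j ^ k"
  shows "\<xi> j ^ m = 1"
    and "coprime k (int m) \<Longrightarrow> \<xi> (k * j) = \<xi> j powi k"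
proof -
  have cong: "\<xi> (i * j) = \<xi> (i' * j)" if "[i = i'] (mod int m)" for i i'
    using that assms(1) by (intro \<xi>_mod cong_scalar_right) (auto intro: cong_dvd_modulus)
  show 1: "\<xi> j ^ m = 1"
  proof -
    obtain k where k: "k > 0" "[int k = 1] (mod int m)" "coprime k K" "coprime (k + m) K"
      using exists_coprime_shift assms by blast
    then have "[int (k + m) = 1] (mod int m)" by (simp add: cong_def)
    \<comment> \<open>Both \<open>k\<close> and \<open>k + m\<close> act on the index as 1, so
      comparing the two powers leaves \<open>\<xi> j ^ m = 1\<close>.\<close>
    then have "\<xi> j ^ (k + m) = \<xi> j" "\<xi> j ^ k = \<xi> j"
      using cong[of "int (k + m)" 1] cong[of "int k" 1] k power[of k j] power[of "k + m" j] by auto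
    then show ?thesis using \<xi>_nonzero[of j] by (simp add: power_add)
  qed
  assume "coprime k (int m)"
  \<comment> \<open>\<open>k\<close> may be negative or share a factor with \<open>K\<close>;
    \<open>l\<close> is a positive representative of its class modulo \<open>m\<close> that is
    coprime to \<open>K\<close>.\<close>
  then obtain l where l: "l > 0" "[int l = k] (mod int m)" "coprime l K"
    using exists_coprime_cong assms by blast
  have "\<xi> (k * j) = \<xi> j ^ l" using cong[OF l(2)] power[OF l(1,3)] by simp
  also have "\<dots> = \<xi> j powi (int l mod int m)" by (simp add: power_int_mod_order[OF 1 assms(3)])
  also have "\<dots> = \<xi> j powi k"
    using l(2) by (simp add: cong_def power_int_mod_order[OF 1 assms(3)])
  finally show "\<xi> (k * j) = \<xi> j powi k" .
qed

text \<open>As \<open>n\<close> is odd, \<open>- x\<close> is an \<open>n\<close>-th root of unity,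
  and the sign is absorbed by writing \<pi> as an odd multiple of \<open>pi / n\<close>. This turns
  the exceptional exponential form into a condition on \<open>\<xi> j ^ n\<close>.\<close>

lemma power_eq_minus_one_iff:
  fixes x :: complex
  assumes n: "n > 0" "odd n"
  shows "x ^ n = -1 \<longleftrightarrow> (\<exists>p :: int. x = exp (of_int (2 * p + 1) * \<i> * of_real pi / of_nat n))"
proof
  assume "x ^ n = -1"
  then have "(- x) ^ n = 1" using n by simp
  then obtain l where "- x = exp (2 * of_real pi * \<i> / of_nat n) ^ l"
    using root_of_unity_eq_power[OF n(1)] by blast
  then have l: "- x = exp (2 * of_real pi * \<i> * of_nat l / of_nat n)"
    by (simp add: mult_ac flip: exp_of_nat_mult)
  obtain q where q: "n = 2 * q + 1" using n(2) by (auto elim: oddE)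
  have "x = exp (of_real pi * \<i>) * exp (2 * of_real pi * \<i> * of_nat l / of_nat n)"
    by (simp flip: l)
  also have "\<dots> = exp (of_int (2 * (int l + int q) + 1) * \<i> * of_real pi / of_nat n)"
  proof -
    have "2 * of_nat q + 1 = (of_nat n :: complex)" by (simp add: q)
    then have "of_real pi * \<i> = (2 * of_nat q + 1) * of_real pi * \<i> / (of_nat n :: complex)"
      using n(1) by simp
    then have "of_real pi * \<i> + 2 * of_real pi * \<i> * of_nat l / of_nat n =
        of_int (2 * (int l + int q) + 1) * \<i> * of_real pi / (of_nat n :: complex)"
      by (simp add: algebra_simps add_divide_distrib)
    then show ?thesis by (simp only: flip: exp_add)
  qed
  finally show "\<exists>p :: int. x = exp (of_int (2 * p + 1) * \<i> * of_real pi / of_nat n)" by blast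
next
  assume "\<exists>p :: int. x = exp (of_int (2 * p + 1) * \<i> * of_real pi / of_nat n)"
  then obtain p :: int where "x = exp (of_int (2 * p + 1) * \<i> * of_real pi / of_nat n)" by blast
  then have "x ^ n = exp (of_int (2 * p + 1) * \<i> * of_real pi)"
    using n by (simp flip: exp_of_nat_mult)
  also have "\<dots> = exp (\<i> * (of_int p * (of_real pi * 2))) * exp (of_real pi * \<i>)"
    by (simp add: algebra_simps flip: exp_add)
  finally show "x ^ n = -1" by simp
qed

theorem theorem2:
  fixes n :: nat and U :: "complex mat"
  assumes "n \<ge> 1"
    and "rational_spectral_unit n U"
    and "finite_order_mat n U"
  shows "(fourier_coeff n U 0 = 1 \<or> fourier_coeff n U 0 = -1) \<and>
    (\<forall>k j :: int. coprime k (int n) \<longrightarrow> j mod int n \<noteq> 0 \<longrightarrow>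
      (even n \<longrightarrow> fourier_coeff n U (k * j) = fourier_coeff n U j powi k) \<and>
      (odd n \<longrightarrow>
        (if even k \<and> (\<exists>p :: int. fourier_coeff n U j =
              exp (of_int (2 * p + 1) * \<i> * of_real pi / of_nat n))
         then fourier_coeff n U (k * j) = - (fourier_coeff n U j powi k)
         else fourier_coeff n U (k * j) = fourier_coeff n U j powi k)))"
proof -
  have n: "n > 0" using assms(1) by simp
  have U: "circulant_mat n U" and rat: "\<And>s. s < n \<Longrightarrow> U $$ (s, 0) \<in> \<rat>"
    using assms n by (auto simp: rational_spectral_unit_def)
  obtain M where M: "M > 0" "U ^\<^sub>m M = 1\<^sub>m n"
    using assms(3) by (auto simp: finite_order_mat_def Suc_le_eq)
  define \<xi> where "\<xi> = fourier_coeff n U"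
  have root: "\<xi> j ^ M = 1" for j
    unfolding \<xi>_def by (rule fourier_coeff_root_of_unity[OF n U M(2)])
  then have nonzero: "\<xi> j \<noteq> 0" for j
    using M(1) by (metis power_eq_0_iff zero_neq_one)
  have mod_n: "\<xi> i = \<xi> j" if "[i = j] (mod int n)" for i j
    using that fourier_coeff_mod unfolding \<xi>_def cong_def by metis
  obtain K where K: "K > 0" "\<And>p j. prime p \<Longrightarrow> coprime p K \<Longrightarrow> \<xi> (int p * j) = \<xi> j ^ p"
    using fourier_coeff_frobenius[OF n U M rat] unfolding \<xi>_def by blast
  have power: "\<xi> (int k * j) = \<xi> j ^ k" if "k > 0" "coprime k K" for k j
    using power_map_of_primes[of K \<xi>] K(2) that by blast

  \<comment> \<open>At index 0 all exponentials are 1, so the value is rational, hence real, and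
    being a root of unity it has norm 1.\<close>
  have "\<xi> 0 = 1 \<or> \<xi> 0 = -1"
  proof -
    have "\<xi> 0 = (\<Sum>s<n. U $$ (s, 0))"
      by (simp add: \<xi>_def fourier_coeff_eq_sum nth_root_def)
    also have "\<dots> \<in> \<rat>" using rat by (intro Rats_sum) auto
    finally have "\<xi> 0 \<in> \<real>" by (auto elim!: Rats_cases')
    then obtain r where r: "\<xi> 0 = of_real r" by (auto elim: Reals_cases)
    have "norm (\<xi> 0) = 1"
      using root[of 0] M(1) by (metis norm_one norm_power norm_ge_zero power_eq_1_iff neq0_conv)
    then have "r = 1 \<or> r = -1" unfolding r by auto
    then show ?thesis unfolding r by auto
  qed
  moreover have "\<xi> (k * j) = \<xi> j powi k" if "even n" "coprime k (int n)" for k j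
    by (rule power_map_of_units(2)[OF dvd_refl that(1) n K(1) mod_n nonzero power that(2)])
  moreover have "if even k \<and> \<xi> j ^ n = -1 then \<xi> (k * j) = - (\<xi> j powi k) else \<xi> (k * j) = \<xi> j powi k"
    if n_odd: "odd n" and k: "coprime k (int n)" for k j
  proof -
    have m: "n dvd 2 * n" "even (2 * n)" "2 * n > 0" using n by auto
    note units = power_map_of_units[OF m K(1) mod_n nonzero power]
    have odd: "\<xi> (l * j) = \<xi> j powi l" if "odd l" "coprime l (int n)" for l
      using that by (intro units(2)) auto
    have "(\<xi> j ^ n) ^ 2 = 1" using units(1)[of j] by (simp add: mult.commute flip: power_mult)
    then have pm: "\<xi> j ^ n = 1 \<or> \<xi> j ^ n = -1" by (simp add: power2_eq_1_iff)
    show ?thesis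
    proof (cases "even k")
      case False
      then show ?thesis using odd k by simp
    next
      case True
      \<comment> \<open>Adding \<open>n\<close> keeps the residue of the index and makes the
        exponent odd, hence coprime to \<open>2 * n\<close>; the extra factor
        \<open>\<xi> j ^ n\<close> is the sign.\<close>
      have "\<xi> (k * j) = \<xi> ((k + int n) * j)"
        by (intro mod_n) (simp add: cong_def algebra_simps)
      also have "\<dots> = \<xi> j powi (k + int n)"
      proof (rule odd)
        show "odd (k + int n)" using True n_odd by simp
        show "coprime (k + int n) (int n)" using k by (metis coprime_iff_gcd_eq_1 gcd_add1)
      qed
      also have "\<dots> = \<xi> j powi k * \<xi> j ^ n" using nonzero by (simp add: power_int_add)
      finally show ?thesis using pm True by auto
    qed
  qed
  ultimately show ?thesis
    unfolding \<xi>_def using power_eq_minus_one_iff[OF n] by auto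
qed

end
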